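(* Let $n<N$ and let $\tilde{\boldsymbol q}:\mathbb{R}^n\to\mathbb{R}^N$, $\tilde{\boldsymbol q}(\boldsymbol\theta)=\boldsymbol s_0+\boldsymbol V\boldsymbol\theta+\boldsymbol W(\boldsymbol\theta\otimes\boldsymbol\theta)$, be the nonlinear parametrization derived from a quadratic manifold whose matrices $\boldsymbol V\in\mathbb{R}^{N\times n}$ and $\boldsymbol W\in\mathbb{R}^{N\times n^2}$ are constructed from data with the greedy approach (as described in the context). Assume that the right-hand side function $\boldsymbol f(\cdot;\boldsymbol\mu):\mathbb{R}^N\to\mathbb{R}^N$ of the semi-discrete full model is continuously differentiable for all $\boldsymbol\mu\in\mathcal D$. Then for any given $t_0\in[0,T)$, $\boldsymbol\mu\in\mathcal D$, and initial condition $\boldsymbol\theta_{t_0}\in\mathbb{R}^n$, there exist $\varepsilon>0$ and a unique trajectory $\boldsymbol\theta(\cdot;\boldsymbol\mu):[t_0,t_0+\varepsilon]\to\mathbb{R}^n$ with $\boldsymbol\theta(t_0;\boldsymbol\mu)=\boldsymbol\theta_{t_0}$ that solves the Neural Galerkin conditions $$\left\langle\partial_{\theta_i}\tilde{\boldsymbol q}(\boldsymbol\theta(t;\boldsymbol\mu)),\;\boldsymbol J(\boldsymbol\theta(t;\boldsymbol\mu))\,\dot{\boldsymbol\theta}(t;\boldsymbol\mu)-\boldsymbol f(\tilde{\boldsymbol q}(\boldsymbol\theta(t;\boldsymbol\mu));\boldsymbol\mu)\right\rangle_2=0,\qquad i=1,\dots,n,$$ for all $t\in[t_0,t_0+\v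arepsilon]$.
   Context: Full model: $\partial_t\boldsymbol q(t;\boldsymbol\mu)=\boldsymbol f(\boldsymbol q(t;\boldsymbol\mu);\boldsymbol\mu)$ for $t\in[0,T]$ is a semi-discrete system with state in $\mathbb{R}^N$, parameter $\boldsymbol\mu\in\mathcal D\subset\mathbb{R}^{d'}$, and right-hand side function $\boldsymbol f:\mathbb{R}^N\times\mathcal D\to\mathbb{R}^N$. Notation: $\langle\cdot,\cdot\rangle_2$ is the Euclidean inner product on $\mathbb{R}^N$; $\dot{\boldsymbol\theta}$ is the time derivative of $\boldsymbol\theta$ (one-sided at interval endpoints; trajectories are understood to be differentiable); $\boldsymbol J(\boldsymbol\theta)=\left[\frac{\partial\tilde q_i}{\partial\theta_j}(\boldsymbol\theta)\right]_{i=1,\dots,N,\;j=1,\dots,n}\in\mathbb{R}^{N\times n}$ is the Jacobian matrix of $\tilde{\boldsymbol q}$, whose $i$-th column is $\partial_{\theta_i}\tilde{\boldsymbol q}(\boldsymbol\theta)$. Quadratic feature map: for $\hat{\boldsymbol s}\in\mathbb{R}^n$, $h(\hat{\boldsymbol s})=\hat{\boldsymbol s}\otimes\hat{\boldsymbol s}=[\hat s_1\hat s_1,\hat s_1\hat s_2,\dots,\hat s_1\hat s_n,\hat s_2\hat s_1,\dots,\hat s_n\hat s_n]^\top\in\mathbb{R}^{n^2}$ (Kronecker product). Quadratic manifold: given a reference point $\boldsymbol s_0\in\mathbb{R}^N$, the encoder is $e_{\boldsymbol V}(\boldsymbol s)=\boldsymbol V^\top(\boldsymbol s-\boldsymbol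 s_0)$ and the decoder is $g_{\boldsymbol V,\boldsymbol W}(\hat{\boldsymbol s})=\boldsymbol s_0+\boldsymbol V\hat{\boldsymbol s}+\boldsymbol W h(\hat{\boldsymbol s})$. The parametrization is $\tilde{\boldsymbol q}=g_{\boldsymbol V,\boldsymbol W}$, with component functions $\tilde q_1,\dots,\tilde q_N$. Greedy construction: given a data matrix $\boldsymbol S=[\boldsymbol s_1,\dots,\boldsymbol s_M]\in\mathbb{R}^{N\times M}$, the greedy method provides a matrix $\boldsymbol V\in\mathbb{R}^{N\times n}$ with orthonormal columns selected among the left-singular vectors of $\boldsymbol S$ (the selection may take both leading and later singular vectors). The matrix $\boldsymbol W$ is then obtained by regularized least-squares regression with a regularization parameter $\gamma>0$, $$\boldsymbol W=\operatorname*{arg\,min}_{\boldsymbol W\in\mathbb{R}^{N\times n^2}}\left\|\boldsymbol V\boldsymbol V^\top\boldsymbol S-\boldsymbol S+\boldsymbol W h(e_{\boldsymbol V}(\boldsymbol S))\right\|_F^2+\gamma\|\boldsymbol W\|_F^2,$$ where $e_{\boldsymbol V}$ and $h$ act column-wise. Matrices constructed in this way satisfy $\boldsymbol V^\top\boldsymbol V=\boldsymbol I$ and $\boldsymbol V^\top\boldsymbol W=\boldsymbol 0$. *)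

theory Defs
  imports "HOL-Analysis.Analysis"
begin

(* A matrix with N rows and n columns has type real^'n^'N; the n^2 entries of a Kronecker
   product are indexed by pairs. *)

definition kron_feature :: "real^'n \<Rightarrow> real^('n \<times> 'n)" where
  "kron_feature s = (\<chi> p. s $ fst p * s $ snd p)"

definition encoder :: "real^'N \<Rightarrow> real^'n^'N \<Rightarrow> real^'N \<Rightarrow> real^'n" where
  "encoder s0 V s = transpose V *v (s - s0)"

definition decoder :: "real^'N \<Rightarrow> real^'n^'N \<Rightarrow> real^('n \<times> 'n)^'N \<Rightarrow> real^'n \<Rightarrow> real^'N" where
  "decoder s0 V W s = s0 + V *v s + W *v kron_feature s"

definition columnwise :: "(real^'a \<Rightarrow> real^'b) \<Rightarrow> real^'m^'a \<Rightarrow> real^'m^'b" where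
  "columnwise F A = (\<chi> i k. F (column k A) $ i)"

(* Full singular value decomposition S = U Sigma Z^T.  Finite index types carry no order, so
   "rectangular diagonal" reads: at most one nonzero entry in each row and in each column.
   A thin decomposition extends to a full one, with more columns in U. *)
definition is_svd ::
    "real^'m^'N \<Rightarrow> real^'N^'N \<Rightarrow> real^'m^'N \<Rightarrow> real^'m^'m \<Rightarrow> bool" where
  "is_svd S U \<Sigma> Z \<longleftrightarrow>
     orthogonal_matrix U \<and> orthogonal_matrix Z \<and>
     S = U ** \<Sigma> ** transpose Z \<and>
     (\<forall>i k. 0 \<le> \<Sigma> $ i $ k) \<and>
     (\<forall>i k l. \<Sigma> $ i $ k \<noteq> 0 \<longrightarrow> \<Sigma> $ i $ l \<noteq> 0 \<longrightarrow> k = l) \<and>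
     (\<forall>i j k. \<Sigma> $ i $ k \<noteq> 0 \<longrightarrow> \<Sigma> $ j $ k \<noteq> 0 \<longrightarrow> i = j)"

(* The columns of V are distinct left-singular vectors (leading or not) of one decomposition
   of S; hence they are orthonormal. *)
definition selected_left_singular_vectors :: "real^'m^'N \<Rightarrow> real^'n^'N \<Rightarrow> bool" where
  "selected_left_singular_vectors S V \<longleftrightarrow>
     (\<exists>U \<Sigma> Z. \<exists>\<sigma> :: 'n \<Rightarrow> 'N. is_svd S U \<Sigma> Z \<and> inj \<sigma> \<and>
        (\<forall>j. column j V = column (\<sigma> j) U))"

(* The norm of the library on real^'b^'a is the Frobenius norm. *)
definition regression_objective ::
    "real^'m^'N \<Rightarrow> real^'N \<Rightarrow> real \<Rightarrow> real^'n^'N \<Rightarrow> real^('n \<times> 'n)^'N \<Rightarrow> real" where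
  "regression_objective S s0 \<gamma> V W =
     (norm (V ** transpose V ** S - S
            + W ** columnwise kron_feature (columnwise (encoder s0 V) S)))\<^sup>2
     + \<gamma> * (norm W)\<^sup>2"

definition greedy_quadratic_manifold ::
    "real^'m^'N \<Rightarrow> real^'N \<Rightarrow> real \<Rightarrow> real^'n^'N \<Rightarrow> real^('n \<times> 'n)^'N \<Rightarrow> bool" where
  "greedy_quadratic_manifold S s0 \<gamma> V W \<longleftrightarrow>
     selected_left_singular_vectors S V \<and>
     is_arg_min (regression_objective S s0 \<gamma> V) (\<lambda>_. True) W"

definition continuously_differentiable ::
    "('a::real_normed_vector \<Rightarrow> 'b::real_normed_vector) \<Rightarrow> bool" where
  "continuously_differentiable F \<longleftrightarrow>
     (\<exists>F' :: 'a \<Rightarrow> 'a \<Rightarrow>\<^sub>L 'b.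
        (\<forall>x. (F has_derivative blinfun_apply (F' x)) (at x)) \<and> continuous_on UNIV F')"

definition partial_derivative :: "(real^'n \<Rightarrow> real^'N) \<Rightarrow> 'n \<Rightarrow> real^'n \<Rightarrow> real^'N" where
  "partial_derivative q i \<theta> = vector_derivative (\<lambda>x. q (\<theta> + x *\<^sub>R axis i 1)) (at 0)"

(* The derivative within the closed interval is one-sided at its endpoints. *)
definition solves_neural_galerkin ::
    "(real^'n \<Rightarrow> real^'N) \<Rightarrow> (real^'N \<Rightarrow> real^'N) \<Rightarrow> real \<Rightarrow> real \<Rightarrow> (real \<Rightarrow> real^'n) \<Rightarrow> bool" where
  "solves_neural_galerkin q F a b \<theta> \<longleftrightarrow>
     (\<forall>t\<in>{a..b}. \<exists>\<theta>'.
        (\<theta> has_vector_derivative \<theta>') (at t within {a..b}) \<and>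
        (\<forall>i. partial_derivative q i (\<theta> t) \<bullet>
              (jacobian q (at (\<theta> t)) *v \<theta>' - F (q (\<theta> t))) = 0))"

end

theory Submission
  imports Defs
begin

text \<open>Let \<open>J \<theta>\<close> denote the derivative of the decoder at \<open>\<theta>\<close>. It maps \<open>v\<close> to \<open>V v\<close> plus a
vector in the range of \<open>W\<close>. The greedy construction makes these two terms orthogonal: the columns of
\<open>V\<close> are orthonormal because they are columns of an orthogonal matrix, and \<open>V\<^sup>T W = 0\<close> because
a part of \<open>W\<close> in the range of \<open>V\<close> cannot reduce the regression residual, which without it is
orthogonal to that range, but is penalized by \<open>\<gamma> > 0\<close>. By Pythagoras
\<open>|J \<theta> v| \<ge> |v|\<close> for all \<open>\<theta>\<close> and \<open>v\<close>
(\<open>norm_le_norm_decoder_tangent\<close>), so \<open>J \<theta>\<close> is injective with a bound that is uniform in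
\<open>\<theta>\<close>.

The Neural Galerkin conditions are the normal equations of the least-squares problem
\<open>J \<theta> \<theta>' \<approx> f (q \<theta>)\<close>. Injectivity gives them exactly one solution
\<open>\<theta>' = g \<theta>\<close>, and a trajectory satisfies the conditions iff it solves the autonomous equation
\<open>\<theta>' = g \<theta>\<close> (\<open>neural_galerkin_iff_ode\<close>). The uniform lower bound, together with the fact that
\<open>J\<close> is affine in \<open>\<theta>\<close> and that \<open>f\<close> is Lipschitz on bounded sets, makes \<open>g\<close>
Lipschitz on bounded sets (\<open>galerkin_velocity_lipschitz\<close>). This estimate works with the normal equations
tested against \<open>g x - g y\<close>; no inverse of \<open>J\<^sup>T J\<close> is differentiated.

What remains is the Picard-Lindeloef theorem for such a vector field
(\<open>locally_lipschitz_ode_exists_unique\<close>): a solution comes from the Banach fixed point theorem, and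
two solutions on the same interval agree by a Gronwall argument. The latter holds on the whole interval,
without the competitor being assumed to stay near the initial value.\<close>

section \<open>Orthogonality of the greedy matrices\<close>

lemma orthonormal_columns_of_selection:
  assumes "selected_left_singular_vectors S V"
  shows "transpose V ** V = mat 1"
proof -
  obtain U \<Sigma> Z \<sigma> where svd: "is_svd S U \<Sigma> Z" and \<sigma>: "inj \<sigma>"
    and V: "\<And>j. column j V = column (\<sigma> j) U"
    using assms unfolding selected_left_singular_vectors_def by auto
  have "transpose U ** U = mat 1"
    using svd by (simp add: is_svd_def orthogonal_matrix_def)
  then have "column i U \<bullet> column j U = (if i = j then 1 else 0)" for i j
    by (simp add: matrix_mult_transpose_dot_column mat_def vec_eq_iff)
  then show ?thesis
    using \<sigma> by (simp add: matrix_mult_transpose_dot_column mat_def vec_eq_iff V inj_eq)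
qed

text \<open>The inner product of matrices is the Frobenius inner product, for which multiplication by the transpose is
the adjoint of multiplication by the matrix.\<close>
lemma inner_matrix_mult_left:
  fixes A :: "real^'k^'n" and B :: "real^'m^'k" and C :: "real^'m^'n"
  shows "(A ** B) \<bullet> C = B \<bullet> (transpose A ** C)"
proof -
  have "(A ** B) \<bullet> C = (\<Sum>i\<in>UNIV. \<Sum>j\<in>UNIV. \<Sum>k\<in>UNIV. A $ i $ k * B $ k $ j * C $ i $ j)"
    by (simp add: inner_vec_def matrix_matrix_mult_def sum_distrib_right)
  also have "\<dots> = (\<Sum>i\<in>UNIV. \<Sum>k\<in>UNIV. \<Sum>j\<in>UNIV. A $ i $ k * B $ k $ j * C $ i $ j)"
    by (intro sum.cong refl, rule sum.swap)
  also have "\<dots> = (\<Sum>k\<in>UNIV. \<Sum>i\<in>UNIV. \<Sum>j\<in>UNIV. A $ i $ k * B $ k $ j * C $ i $ j)"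
    by (rule sum.swap)
  also have "\<dots> = (\<Sum>k\<in>UNIV. \<Sum>j\<in>UNIV. \<Sum>i\<in>UNIV. A $ i $ k * B $ k $ j * C $ i $ j)"
    by (intro sum.cong refl, rule sum.swap)
  also have "\<dots> = B \<bullet> (transpose A ** C)"
    by (simp add: inner_vec_def matrix_matrix_mult_def transpose_def sum_distrib_left mult_ac)
  finally show ?thesis .
qed

lemma matrix_diff_ldistrib: "A ** (B - C) = A ** B - A ** C"
  for A :: "'a::ring_1^'k^'n" and B C :: "'a^'m^'k"
  by (vector matrix_matrix_mult_def sum_subtractf[symmetric] right_diff_distrib)

lemma matrix_diff_rdistrib: "(A - B) ** C = A ** C - B ** C"
  for A B :: "'a::ring_1^'k^'n" and C :: "'a^'m^'k"
  by (vector matrix_matrix_mult_def sum_subtractf[symmetric] left_diff_distrib)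

text \<open>Let \<open>P = V V\<^sup>T\<close>, the orthogonal projection onto the range of \<open>V\<close>, and compare \<open>W\<close>
with the competitor \<open>W - P W\<close>. The data term \<open>P S - S\<close> is orthogonal to that range, so by
Pythagoras removing \<open>P W\<close> does not increase the residual and lowers the penalty by exactly
\<open>\<gamma> |P W|\<^sup>2\<close>. A minimizer therefore has \<open>P W = 0\<close>.\<close>
lemma regression_minimizer_orthogonal:
  fixes V :: "real^'n^'N"
  assumes VV: "transpose V ** V = mat 1" and \<gamma>: "\<gamma> > 0"
    and min: "is_arg_min (regression_objective S s0 \<gamma> V) (\<lambda>_. True) W"
  shows "transpose V ** W = 0"
proof -
  define P where "P = V ** transpose V"
  define H where "H = columnwise kron_feature (columnwise (encoder s0 V) S)"
  define W' where "W' = W - P ** W"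
  define R where "R = P ** S - S + W' ** H"
  have PT: "transpose P = P"
    by (simp add: P_def matrix_transpose_mul)
  have PP: "P ** P = P"
    by (metis P_def VV matrix_mul_assoc matrix_mul_rid)
  have PP': "P ** (P ** Z) = P ** Z" for Z :: "real^'c^'N"
    by (simp add: matrix_mul_assoc PP)
  have PW': "P ** W' = 0"
    by (simp add: W'_def matrix_diff_ldistrib PP')
  have PR: "P ** R = 0"
    by (simp add: R_def matrix_diff_ldistrib matrix_add_ldistrib matrix_mul_assoc PW' PP)
  have pyth: "(norm (A + P ** B))\<^sup>2 = (norm A)\<^sup>2 + (norm (P ** B))\<^sup>2"
    if "P ** A = 0" for A B :: "real^'c^'N"
  proof -
    have "(P ** B) \<bullet> A = 0"
      using that by (simp add: inner_matrix_mult_left PT)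
    then show ?thesis
      by (simp add: power2_norm_eq_inner inner_add inner_commute)
  qed
  have "regression_objective S s0 \<gamma> V W
      = (norm (R + P ** (W ** H)))\<^sup>2 + \<gamma> * (norm (W' + P ** W))\<^sup>2"
    by (simp add: regression_objective_def R_def W'_def H_def P_def
        matrix_diff_rdistrib matrix_mul_assoc algebra_simps)
  also have "\<dots> = regression_objective S s0 \<gamma> V W'
      + (norm (P ** (W ** H)))\<^sup>2 + \<gamma> * (norm (P ** W))\<^sup>2"
    by (simp only: pyth[OF PR] pyth[OF PW'])
      (simp add: regression_objective_def R_def H_def P_def distrib_left)
  finally have "(norm (P ** (W ** H)))\<^sup>2 + \<gamma> * (norm (P ** W))\<^sup>2 \<le> 0"
    using min by (auto simp: is_arg_min_def not_less dest: spec[of _ W'])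
  then have "P ** W = 0"
    using \<gamma> by (smt (verit) mult_pos_pos zero_less_power2 zero_le_power2 norm_eq_zero)
  then have "transpose V ** (P ** W) = 0"
    by simp
  then show ?thesis
    by (simp add: P_def matrix_mul_assoc VV)
qed

section \<open>Least-squares velocities\<close>

text \<open>Here \<open>g x\<close> solves the least-squares problem for \<open>J x\<close> and \<open>F x\<close>. With
\<open>d = g x - g y\<close>, the normal equations at \<open>x\<close> give
\<open>|J x d|\<^sup>2 = J x d \<bullet> (F x - J x (g y))\<close>. The right-hand side is split into the variation of
\<open>F\<close>, the variation of \<open>J\<close> applied to \<open>g y\<close>, and the residual at \<open>y\<close>; the residual is
orthogonal to \<open>J y d\<close>, so only \<open>J x d - J y d\<close> contributes. One factor \<open>|J x d|\<close> then
cancels and coercivity bounds the other from below by \<open>|d|\<close>. The variation of \<open>J\<close> enters once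
through \<open>|J y (g y)| \<le> M\<close> and once through the residual, bounded by \<open>2 M\<close>: hence the
constant \<open>3 K M\<close>.\<close>
lemma galerkin_velocity_lipschitz:
  fixes J :: "'a::real_normed_vector \<Rightarrow> 'b::real_normed_vector \<Rightarrow> 'c::real_inner"
  assumes lin: "\<And>x. linear (J x)"
    and coercive: "\<And>x v. norm v \<le> norm (J x v)"
    and J_lip: "\<And>x y v. norm (J x v - J y v) \<le> K * norm (x - y) * norm v" and K: "0 \<le> K"
    and F_lip: "L-lipschitz_on X F"
    and F_bound: "\<And>x. x \<in> X \<Longrightarrow> norm (F x) \<le> M"
    and galerkin: "\<And>x v. x \<in> X \<Longrightarrow> J x v \<bullet> (J x (g x) - F x) = 0"
  shows "(L + 3 * K * \<bar>M\<bar>)-lipschitz_on X g"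
proof (rule lipschitz_onI)
  have L: "0 \<le> L" by (rule lipschitz_on_nonneg[OF F_lip])
  then show "0 \<le> L + 3 * K * \<bar>M\<bar>" using K by simp
  have Jg: "norm (J x (g x)) \<le> \<bar>M\<bar>" if "x \<in> X" for x
  proof -
    have "norm (J x (g x)) * norm (J x (g x)) = J x (g x) \<bullet> F x"
      using galerkin[OF that, of "g x"]
      by (simp add: inner_diff_right dot_square_norm power2_eq_square)
    also have "\<dots> \<le> norm (J x (g x)) * norm (F x)"
      by (rule norm_cauchy_schwarz)
    finally have "norm (J x (g x)) \<le> norm (F x)"
      by (metis mult_le_cancel_left norm_ge_zero order_le_less)
    then show ?thesis using F_bound[OF that] by simp
  qed
  fix x y assume x: "x \<in> X" and y: "y \<in> X"
  define d where "d = g x - g y"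
  define s where "s = norm (J x d)"
  define \<delta> where "\<delta> = norm (x - y)"
  have ds: "norm d \<le> s" by (simp add: s_def coercive)
  have KD: "0 \<le> K * \<delta>" using K by (simp add: \<delta>_def)
  have "s * s = J x d \<bullet> J x d"
    by (simp add: s_def dot_square_norm power2_eq_square)
  also have "\<dots> = J x d \<bullet> (F x - J x (g y))"
    using galerkin[OF x, of d] linear_diff[OF lin, of x "g x" "g y"]
    by (simp add: d_def inner_diff_right)
  also have "\<dots> = J x d \<bullet> (F x - F y) + (J x d - J y d) \<bullet> (F y - J y (g y))
      + J x d \<bullet> (J y (g y) - J x (g y))"
    using galerkin[OF y, of d] by (simp add: inner_diff_right inner_diff_left)
  also have "\<dots> \<le> s * (L * \<delta>) + (K * \<delta> * s) * (2 * \<bar>M\<bar>) + s * (K * \<delta> * \<bar>M\<bar>)"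
  proof (intro add_mono)
    have "norm (F x - F y) \<le> L * \<delta>"
      using lipschitz_onD[OF F_lip x y] by (simp add: dist_norm \<delta>_def)
    then show "J x d \<bullet> (F x - F y) \<le> s * (L * \<delta>)"
      unfolding s_def by (intro order_trans[OF norm_cauchy_schwarz] mult_left_mono) auto
    have "norm (J x d - J y d) \<le> K * \<delta> * s"
      using J_lip[of x d y] mult_left_mono[OF ds KD] by (simp add: \<delta>_def)
    moreover have "norm (F y - J y (g y)) \<le> 2 * \<bar>M\<bar>"
      using norm_triangle_ineq4[of "F y" "J y (g y)"] F_bound[OF y] Jg[OF y] by simp
    ultimately show "(J x d - J y d) \<bullet> (F y - J y (g y)) \<le> (K * \<delta> * s) * (2 * \<bar>M\<bar>)"
      using KD by (intro order_trans[OF norm_cauchy_schwarz] mult_mono) (auto simp: s_def)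
    have "norm (g y) \<le> \<bar>M\<bar>"
      using coercive[of "g y" y] Jg[OF y] by simp
    then have "norm (J y (g y) - J x (g y)) \<le> K * \<delta> * \<bar>M\<bar>"
      using J_lip[of y "g y" x] mult_left_mono[OF _ KD, of "norm (g y)" "\<bar>M\<bar>"]
      by (simp add: \<delta>_def norm_minus_commute)
    then show "J x d \<bullet> (J y (g y) - J x (g y)) \<le> s * (K * \<delta> * \<bar>M\<bar>)"
      unfolding s_def by (intro order_trans[OF norm_cauchy_schwarz] mult_left_mono) auto
  qed
  also have "\<dots> = s * ((L + 3 * K * \<bar>M\<bar>) * \<delta>)"
    by (simp add: algebra_simps)
  finally have "s * s \<le> s * ((L + 3 * K * \<bar>M\<bar>) * \<delta>)" .
  then have "s \<le> (L + 3 * K * \<bar>M\<bar>) * \<delta>"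
    using L K by (cases "s = 0") (auto simp: s_def \<delta>_def mult_le_cancel_left)
  then show "dist (g x) (g y) \<le> (L + 3 * K * \<bar>M\<bar>) * dist x y"
    using ds by (simp add: dist_norm d_def \<delta>_def)
qed

text \<open>A solution is a preimage of the orthogonal projection of \<open>y\<close> onto the range of \<open>A\<close>.\<close>
lemma ex_galerkin_solution:
  fixes A :: "'a::euclidean_space \<Rightarrow> 'b::euclidean_space"
  assumes "linear A"
  shows "\<exists>g. \<forall>v. A v \<bullet> (A g - y) = 0"
proof -
  have span: "span (range A) = range A"
    using linear_subspace_image[OF assms subspace_UNIV] by simp
  obtain p z where p: "p \<in> range A" and z: "\<And>w. w \<in> range A \<Longrightarrow> orthogonal z w"
    and y: "y = p + z"
    using orthogonal_subspace_decomp_exists[of "range A" y] by (auto simp: span)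
  obtain g where "p = A g" using p by blast
  then show ?thesis
    using z unfolding orthogonal_def by (intro exI[of _ g]) (simp add: y inner_commute[of _ z])
qed

lemma continuously_differentiable_imp_lipschitz_on_bounded:
  fixes F :: "'a::euclidean_space \<Rightarrow> 'b::real_normed_vector"
  assumes "continuously_differentiable F" and "bounded X"
  shows "\<exists>L. L-lipschitz_on X F"
proof -
  obtain F' where F': "\<And>x. (F has_derivative blinfun_apply (F' x)) (at x)"
    and cont: "continuous_on UNIV F'"
    using assms(1) unfolding continuously_differentiable_def by blast
  obtain R where R: "X \<subseteq> cball 0 R"
    using assms(2) unfolding bounded_iff by (force simp: subset_iff)
  have "compact (F' ` cball 0 R)"
    by (intro compact_continuous_image continuous_on_subset[OF cont]) auto
  then obtain C where C: "C > 0" "\<And>x. x \<in> cball 0 R \<Longrightarrow> norm (F' x) \<le> C"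
    using compact_imp_bounded bounded_pos by (metis image_eqI)
  have "C-lipschitz_on (cball 0 R) F"
    by (rule bounded_derivative_imp_lipschitz[of _ _ "\<lambda>x. blinfun_apply (F' x)"])
      (use F' C in \<open>auto simp: has_derivative_at_withinI norm_blinfun.rep_eq\<close>)
  then show ?thesis
    using R lipschitz_on_subset by blast
qed

section \<open>The derivative of the quadratic decoder\<close>

text \<open>The feature map is the diagonal of this bilinear map, which reduces its differentiation to the product
rule.\<close>
definition kronecker :: "real^'n \<Rightarrow> real^'n \<Rightarrow> real^('n \<times> 'n)" where
  "kronecker x y = (\<chi> p. x $ fst p * y $ snd p)"

lemma kron_feature_eq_kronecker: "kron_feature x = kronecker x x"
  by (simp add: kron_feature_def kronecker_def)

lemma bounded_bilinear_kronecker: "bounded_bilinear kronecker"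
proof -
  have "bilinear kronecker"
    unfolding bilinear_def kronecker_def
    by (auto intro!: linearI simp: vec_eq_iff algebra_simps)
  then show ?thesis
    by (simp add: bilinear_conv_bounded_bilinear)
qed

definition decoder_tangent ::
    "real^'n^'N \<Rightarrow> real^('n \<times> 'n)^'N \<Rightarrow> real^'n \<Rightarrow> real^'n \<Rightarrow> real^'N" where
  "decoder_tangent V W \<theta> v = V *v v + W *v (kronecker \<theta> v + kronecker v \<theta>)"

lemma decoder_has_derivative:
  "(decoder s0 V W has_derivative decoder_tangent V W \<theta>) (at \<theta>)"
proof -
  have "(kron_feature has_derivative (\<lambda>v. kronecker \<theta> v + kronecker v \<theta>)) (at \<theta>)"
    unfolding kron_feature_eq_kronecker[abs_def]
    by (rule bounded_bilinear.FDERIV[OF bounded_bilinear_kronecker has_derivative_ident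
        has_derivative_ident])
  from bounded_linear.has_derivative[OF matrix_vector_mul_bounded_linear this, of W]
    bounded_linear.has_derivative[OF matrix_vector_mul_bounded_linear has_derivative_ident, of V]
  have "((\<lambda>s. s0 + V *v s + W *v kron_feature s) has_derivative
      (\<lambda>v. 0 + V *v v + W *v (kronecker \<theta> v + kronecker v \<theta>))) (at \<theta>)"
    by (intro has_derivative_add has_derivative_const)
  then show ?thesis
    by (simp add: decoder_def[abs_def] decoder_tangent_def[abs_def])
qed

lemma linear_decoder_tangent: "linear (decoder_tangent V W \<theta>)"
  by (rule has_derivative_linear[OF decoder_has_derivative])

text \<open>The tangent map is affine in the base point, so its increments are values of a bounded bilinear map.\<close>
lemma decoder_tangent_lipschitz:
  fixes V :: "real^'n^'N"
  obtains K where "K > 0"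
    and "\<And>x y v. norm (decoder_tangent V W x v - decoder_tangent V W y v)
           \<le> K * norm (x - y) * norm v"
proof -
  interpret kr: bounded_bilinear "kronecker :: real^'n \<Rightarrow> _"
    by (rule bounded_bilinear_kronecker)
  have "bilinear (\<lambda>\<theta> v. W *v (kronecker \<theta> v + kronecker v \<theta>))"
    unfolding bilinear_def
    by (auto intro!: linearI simp: kr.add_left kr.add_right kr.scaleR_left kr.scaleR_right
        matrix_vector_right_distrib matrix_vector_mult_scaleR scaleR_add_right)
  then have "bounded_bilinear (\<lambda>\<theta> v. W *v (kronecker \<theta> v + kronecker v \<theta>))"
    by (simp add: bilinear_conv_bounded_bilinear)
  then obtain K where "K > 0"
    and K: "\<And>\<theta> v. norm (W *v (kronecker \<theta> v + kronecker v \<theta>)) \<le> norm \<theta> * norm v * K"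
    using bounded_bilinear.pos_bounded by blast
  have "norm (decoder_tangent V W x v - decoder_tangent V W y v) \<le> K * norm (x - y) * norm v"
    for x y v
  proof -
    have "decoder_tangent V W x v - decoder_tangent V W y v
        = W *v (kronecker (x - y) v + kronecker v (x - y))"
      by (simp add: decoder_tangent_def kr.diff_left kr.diff_right algebra_simps)
    then show ?thesis
      using K[of "x - y" v] by (simp add: mult_ac)
  qed
  with \<open>K > 0\<close> show thesis by (rule that)
qed

lemma partial_derivative_decoder:
  "partial_derivative (decoder s0 V W) i \<theta> = decoder_tangent V W \<theta> (axis i 1)"
proof -
  have shift: "((\<lambda>x::real. \<theta> + x *\<^sub>R axis i 1) has_derivative (\<lambda>x. x *\<^sub>R axis i 1)) (at 0)"
    by (auto intro!: derivative_eq_intros)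
  have "((\<lambda>x. decoder s0 V W (\<theta> + x *\<^sub>R axis i 1)) has_derivative
      (\<lambda>x. decoder_tangent V W \<theta> (x *\<^sub>R axis i 1))) (at 0)"
    by (rule has_derivative_compose[OF shift]) (simp add: decoder_has_derivative)
  then show ?thesis
    unfolding partial_derivative_def
    by (intro vector_derivative_at)
      (simp add: has_vector_derivative_def linear_cmul[OF linear_decoder_tangent])
qed

lemma jacobian_decoder: "jacobian (decoder s0 V W) (at \<theta>) *v v = decoder_tangent V W \<theta> v"
proof -
  have "decoder s0 V W differentiable at \<theta>"
    using decoder_has_derivative by (rule differentiableI)
  then show ?thesis
    using has_derivative_unique[OF decoder_has_derivative[of s0 V W \<theta>]]
    by (metis jacobian_works)
qed

text \<open>Testing against the \<open>n\<close> partial derivatives is testing against the whole tangent space; the latter form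
can be used with coordinate-free arguments.\<close>
lemma inner_zero_on_axes_iff:
  fixes A :: "real^'n \<Rightarrow> 'b::real_inner"
  assumes "linear A"
  shows "(\<forall>i. A (axis i 1) \<bullet> y = 0) \<longleftrightarrow> (\<forall>v. A v \<bullet> y = 0)"
proof
  assume axes: "\<forall>i. A (axis i 1) \<bullet> y = 0"
  have "A v \<bullet> y = 0" for v
  proof -
    have "A v = A (\<Sum>i\<in>UNIV. v $ i *\<^sub>R axis i 1)"
      using basis_expansion[of v] by (simp add: scalar_mult_eq_scaleR)
    also have "\<dots> = (\<Sum>i\<in>UNIV. v $ i *\<^sub>R A (axis i 1))"
      by (simp add: linear_sum[OF assms] linear_cmul[OF assms])
    finally show ?thesis
      using axes by (simp add: inner_sum_left)
  qed
  then show "\<forall>v. A v \<bullet> y = 0" by simp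
qed simp

text \<open>The orthogonality relations enter only here: \<open>V\<close> is an isometry and its range is orthogonal to that
of \<open>W\<close>, so the quadratic term can only lengthen the image. The bound does not depend on
\<open>\<theta>\<close>.\<close>
lemma norm_le_norm_decoder_tangent:
  assumes VV: "transpose V ** V = mat 1" and VW: "transpose V ** W = 0"
  shows "norm v \<le> norm (decoder_tangent V W \<theta> v)"
proof -
  have V_inner: "(V *v v) \<bullet> y = v \<bullet> (transpose V *v y)" for y
    by (metis dot_lmul_matrix vector_transpose_matrix)
  have norm_V: "(norm (V *v v))\<^sup>2 = (norm v)\<^sup>2"
    by (simp add: power2_norm_eq_inner V_inner matrix_vector_mul_assoc VV)
  have orth: "(V *v v) \<bullet> (W *v z) = 0" for z
    by (simp add: V_inner matrix_vector_mul_assoc VW)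
  have "(norm v)\<^sup>2 \<le> (norm (decoder_tangent V W \<theta> v))\<^sup>2"
    unfolding decoder_tangent_def
    by (simp add: norm_add_Pythagorean orthogonal_def orth norm_V)
  then show ?thesis
    by (rule power2_le_imp_le) simp
qed

lemma decoder_lipschitz_on_bounded:
  fixes V :: "real^'n^'N"
  assumes "bounded X"
  shows "\<exists>C. C-lipschitz_on X (decoder s0 V W)"
proof -
  obtain K where K: "K > 0"
    "\<And>x y v. norm (decoder_tangent V W x v - decoder_tangent V W y v)
           \<le> K * norm (x - y) * norm v"
    by (rule decoder_tangent_lipschitz[of V W]) blast
  obtain B where B: "B > 0" "\<And>v. norm (decoder_tangent V W 0 v) \<le> norm v * B"
    using bounded_linear.pos_bounded[OF has_derivative_bounded_linear[OF decoder_has_derivative]]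
    by blast
  obtain R where R: "X \<subseteq> cball 0 R" "R > 0"
    using assms unfolding bounded_pos by (force simp: subset_iff)
  have "(K * R + B)-lipschitz_on (cball 0 R) (decoder s0 V W)"
  proof (rule bounded_derivative_imp_lipschitz)
    fix x :: "real^'n" assume x: "x \<in> cball 0 R"
    show "(decoder s0 V W has_derivative decoder_tangent V W x) (at x within cball 0 R)"
      by (rule has_derivative_at_withinI[OF decoder_has_derivative])
    show "onorm (decoder_tangent V W x) \<le> K * R + B"
    proof (rule onorm_bound)
      fix v
      have "norm (decoder_tangent V W x v) \<le> K * norm x * norm v + norm v * B"
        using K(2)[of x v 0] B(2)[of v]
          norm_triangle_sub[of "decoder_tangent V W x v" "decoder_tangent V W 0 v"] by simp
      also have "\<dots> \<le> K * R * norm v + norm v * B"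
        using x K(1) by (intro add_right_mono mult_right_mono mult_left_mono) auto
      finally show "norm (decoder_tangent V W x v) \<le> (K * R + B) * norm v"
        by (simp add: algebra_simps)
    qed (use K(1) B(1) R(2) in simp)
  qed (use K(1) B(1) R(2) in simp_all)
  then show ?thesis
    using R(1) lipschitz_on_subset by blast
qed

section \<open>Local existence and uniqueness for Lipschitz vector fields\<close>

text \<open>Picard iteration. The integral operator acts on the bounded continuous functions on the whole real line with
values in the ball; its upper integration limit is clamped to the time interval, so that the values are defined and
continuous everywhere. The step \<open>\<epsilon>\<close> is small enough that the operator preserves the ball
(\<open>M \<epsilon> \<le> r\<close>, where \<open>M\<close> bounds \<open>G\<close> on the ball) and halves distances
(\<open>L \<epsilon> \<le> 1 / 2\<close>).\<close>
lemma lipschitz_ode_local_existence: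
  fixes G :: "'a::banach \<Rightarrow> 'a" and t0 :: real
  assumes lip: "L-lipschitz_on (cball x0 r) G" and r: "r > 0"
  obtains \<epsilon> u where "\<epsilon> > 0" and "u t0 = x0"
    and "\<And>t. t \<in> {t0..t0 + \<epsilon>} \<Longrightarrow>
           (u has_vector_derivative G (u t)) (at t within {t0..t0 + \<epsilon>})"
proof -
  define M where "M = norm (G x0) + L * r"
  have L0: "L \<ge> 0" by (rule lipschitz_on_nonneg[OF lip])
  have M0: "M \<ge> 0" using L0 r by (simp add: M_def)
  have Gbound: "norm (G y) \<le> M" if "y \<in> cball x0 r" for y
  proof -
    have "dist (G y) (G x0) \<le> L * dist y x0"
      using lipschitz_onD[OF lip that, of x0] r by simp
    also have "\<dots> \<le> L * r"
      using that L0 by (intro mult_left_mono) (auto simp: dist_commute)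
    finally show ?thesis
      using norm_triangle_sub[of "G y" "G x0"] by (simp add: M_def dist_norm)
  qed
  define \<epsilon> where "\<epsilon> = min (r / (M + 1)) (1 / (2 * (L + 1)))"
  have \<epsilon>: "\<epsilon> > 0" using r M0 L0 by (simp add: \<epsilon>_def)
  have "M * \<epsilon> \<le> M * (r / (M + 1))"
    using M0 by (intro mult_left_mono) (simp_all add: \<epsilon>_def)
  also have "\<dots> \<le> r" using M0 r by (simp add: field_simps)
  finally have \<epsilon>M: "M * \<epsilon> \<le> r" .
  have "L * \<epsilon> \<le> L * (1 / (2 * (L + 1)))"
    using L0 by (intro mult_left_mono) (simp_all add: \<epsilon>_def)
  also have "\<dots> \<le> 1 / 2" using L0 by (simp add: field_simps)
  finally have \<epsilon>L: "L * \<epsilon> \<le> 1 / 2" .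
  let ?b = "t0 + \<epsilon>"
  have clamp: "t0 \<le> clamp t0 ?b t" "clamp t0 ?b t \<le> ?b" for t
    using clamp_in_interval[of t0 ?b t] \<epsilon> by auto
  define S :: "(real \<Rightarrow>\<^sub>C 'a) set" where "S = PiC UNIV (\<lambda>_. cball x0 r)"
  have S_iff: "\<phi> \<in> S \<longleftrightarrow> (\<forall>t. apply_bcontfun \<phi> t \<in> cball x0 r)" for \<phi>
    by (auto simp: S_def mem_PiC_iff)
  define \<Phi> where
    "\<Phi> = (\<lambda>\<phi> t. x0 + integral {t0..clamp t0 ?b t} (\<lambda>s. G (apply_bcontfun \<phi> s)))"
  have cont: "continuous_on A (\<lambda>s. G (apply_bcontfun \<phi> s))" if "\<phi> \<in> S" for \<phi> A
    by (rule continuous_on_compose2[OF lipschitz_on_continuous_on[OF lip]])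
      (use that S_iff in auto)
  have \<Phi>_ball: "\<Phi> \<phi> t \<in> cball x0 r" if "\<phi> \<in> S" for \<phi> t
  proof -
    have "norm (integral {t0..clamp t0 ?b t} (\<lambda>s. G (apply_bcontfun \<phi> s)))
        \<le> M * (clamp t0 ?b t - t0)"
      using that by (intro integral_bound clamp cont Gbound) (auto simp: S_iff)
    also have "\<dots> \<le> M * \<epsilon>" using M0 clamp(2)[of t] by (intro mult_left_mono) auto
    finally show ?thesis using \<epsilon>M by (simp add: \<Phi>_def dist_norm)
  qed
  have \<Phi>_cont: "continuous_on UNIV (\<Phi> \<phi>)" if "\<phi> \<in> S" for \<phi>
    unfolding \<Phi>_def
    by (rule clamp_continuous_on)
      (auto intro!: continuous_intros indefinite_integral_continuous_1
        integrable_continuous_real cont that)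
  define P where "P \<phi> = Bcontfun (\<Phi> \<phi>)" for \<phi>
  have P: "apply_bcontfun (P \<phi>) = \<Phi> \<phi>" if "\<phi> \<in> S" for \<phi>
    unfolding P_def
    by (rule Bcontfun_inverse)
      (use that \<Phi>_cont \<Phi>_ball in \<open>auto simp: bcontfun_def intro!: bounded_subset[OF bounded_cball]\<close>)
  have "\<exists>!\<phi>\<in>S. P \<phi> = \<phi>"
  proof (rule Banach_fix)
    show "complete S"
      unfolding S_def complete_eq_closed by (intro closed_PiC) simp
    have "const_bcontfun x0 \<in> S"
      using r by (simp add: S_iff const_bcontfun.rep_eq)
    then show "S \<noteq> {}" by blast
    show "P ` S \<subseteq> S"
      using \<Phi>_ball P by (auto simp: S_iff)
    fix \<phi> \<psi> assume \<phi>: "\<phi> \<in> S" and \<psi>: "\<psi> \<in> S"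
    show "dist (P \<phi>) (P \<psi>) \<le> 1 / 2 * dist \<phi> \<psi>"
    proof (rule dist_bound)
      fix t
      let ?g = "\<lambda>s. G (apply_bcontfun \<phi> s) - G (apply_bcontfun \<psi> s)"
      have "norm (?g s) \<le> L * dist \<phi> \<psi>" for s
      proof -
        have "norm (?g s) \<le> L * dist (apply_bcontfun \<phi> s) (apply_bcontfun \<psi> s)"
          using lipschitz_onD[OF lip, of "apply_bcontfun \<phi> s" "apply_bcontfun \<psi> s"] \<phi> \<psi>
          by (simp add: S_iff dist_norm)
        also have "\<dots> \<le> L * dist \<phi> \<psi>"
          by (intro mult_left_mono dist_bounded L0)
        finally show ?thesis .
      qed
      then have "norm (integral {t0..clamp t0 ?b t} ?g)
          \<le> L * dist \<phi> \<psi> * (clamp t0 ?b t - t0)"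
        using \<phi> \<psi> by (intro integral_bound clamp continuous_intros cont)
      also have "\<dots> \<le> L * dist \<phi> \<psi> * \<epsilon>"
        using L0 clamp(2)[of t] by (intro mult_left_mono) auto
      also have "\<dots> = (L * \<epsilon>) * dist \<phi> \<psi>" by simp
      also have "\<dots> \<le> 1 / 2 * dist \<phi> \<psi>"
        by (intro mult_right_mono \<epsilon>L) simp
      finally show "dist (apply_bcontfun (P \<phi>) t) (apply_bcontfun (P \<psi>) t) \<le> 1 / 2 * dist \<phi> \<psi>"
        using \<phi> \<psi> by (simp add: P \<Phi>_def dist_norm Henstock_Kurzweil_Integration.integral_diff[symmetric]
            integrable_continuous_real cont)
    qed
  qed auto
  then obtain \<phi> where \<phi>: "\<phi> \<in> S" "P \<phi> = \<phi>" by blast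
  let ?u = "apply_bcontfun \<phi>"
  have u: "?u t = x0 + integral {t0..t} (\<lambda>s. G (?u s))" if "t \<in> {t0..?b}" for t
  proof -
    have "?u t = \<Phi> \<phi> t" using P[OF \<phi>(1)] \<phi>(2) by simp
    then show ?thesis using that by (simp add: \<Phi>_def)
  qed
  show thesis
  proof
    show "\<epsilon> > 0" by (rule \<epsilon>)
    show "?u t0 = x0" using u[of t0] \<epsilon> by simp
    fix t assume t: "t \<in> {t0..?b}"
    have "((\<lambda>t. x0 + integral {t0..t} (\<lambda>s. G (?u s))) has_vector_derivative G (?u t))
        (at t within {t0..?b})"
      using integral_has_vector_derivative[OF cont[OF \<phi>(1)] t]
      by (auto intro!: derivative_eq_intros)
    then show "(?u has_vector_derivative G (?u t)) (at t within {t0..?b})"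
      by (rule has_vector_derivative_transform[OF t u, rotated])
  qed
qed

text \<open>A Gronwall argument: the Lipschitz bound gives \<open>(|u - v|\<^sup>2)' \<le> 2 L |u - v|\<^sup>2\<close>, so the weight
\<open>exp (- 2 L (t - a))\<close> makes the squared distance nonincreasing from its initial value 0.\<close>
lemma lipschitz_ode_unique:
  fixes G :: "'a::real_inner \<Rightarrow> 'a"
  assumes lip: "L-lipschitz_on X G"
    and u: "\<And>t. t \<in> {a..b} \<Longrightarrow> (u has_vector_derivative G (u t)) (at t within {a..b})"
    and v: "\<And>t. t \<in> {a..b} \<Longrightarrow> (v has_vector_derivative G (v t)) (at t within {a..b})"
    and uX: "u ` {a..b} \<subseteq> X" and vX: "v ` {a..b} \<subseteq> X"
    and init: "u a = v a"
    and t: "t \<in> {a..b}"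
  shows "u t = v t"
proof -
  define w where "w s = exp (- 2 * L * (s - a)) * ((u s - v s) \<bullet> (u s - v s))" for s
  have w': "(w has_vector_derivative
      exp (- 2 * L * (s - a)) * (2 * ((u s - v s) \<bullet> (G (u s) - G (v s)))
        - 2 * L * ((u s - v s) \<bullet> (u s - v s)))) (at s within {a..b})"
    if "s \<in> {a..b}" for s
  proof -
    let ?d = "\<lambda>s. u s - v s" and ?A = "at s within {a..b}"
    have "(?d has_vector_derivative G (u s) - G (v s)) ?A"
      by (intro derivative_intros u v that)
    from bounded_bilinear.has_vector_derivative[OF bounded_bilinear_inner this this]
    have "((\<lambda>s. ?d s \<bullet> ?d s) has_vector_derivative 2 * (?d s \<bullet> (G (u s) - G (v s)))) ?A"
      by (simp add: inner_commute)
    then have q: "((\<lambda>s. ?d s \<bullet> ?d s) has_real_derivative 2 * (?d s \<bullet> (G (u s) - G (v s)))) ?A"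
      by (simp add: has_real_derivative_iff_has_vector_derivative)
    have e: "((\<lambda>s. exp (- 2 * L * (s - a))) has_real_derivative
        - 2 * L * exp (- 2 * L * (s - a))) ?A"
      by (auto intro!: derivative_eq_intros)
    show ?thesis
      unfolding w_def[abs_def] has_real_derivative_iff_has_vector_derivative[symmetric]
      by (rule DERIV_cong[OF DERIV_mult[OF e q]]) (simp add: algebra_simps)
  qed
  have "w t \<le> w a"
  proof (rule DERIV_nonpos_imp_decreasing_open[of a t w])
    show "a \<le> t" using t by simp
    \<comment> \<open>The derivative of \<open>w\<close> is one-sided at the endpoints, so monotonicity is deduced from the
      open interval and continuity.\<close>
    have "continuous_on {a..b} w"
      by (rule continuous_on_vector_derivative, rule w')
    then show "continuous_on {a..t} w"
      by (rule continuous_on_subset) (use t in auto)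
    fix s assume s: "a < s" "s < t"
    then have sab: "s \<in> {a..b}" using t by auto
    let ?d = "u s - v s"
    have "?d \<bullet> (G (u s) - G (v s)) \<le> norm ?d * norm (G (u s) - G (v s))"
      by (rule norm_cauchy_schwarz)
    also have "\<dots> \<le> norm ?d * (L * norm ?d)"
      using lipschitz_onD[OF lip, of "u s" "v s"] uX vX sab
      by (intro mult_left_mono) (auto simp: dist_norm image_subset_iff)
    also have "\<dots> = L * (?d \<bullet> ?d)" by (simp add: power2_norm_eq_inner[symmetric] power2_eq_square)
    finally have "2 * (?d \<bullet> (G (u s) - G (v s))) - 2 * L * (?d \<bullet> ?d) \<le> 0" by simp
    then have "exp (- 2 * L * (s - a)) *
        (2 * (?d \<bullet> (G (u s) - G (v s))) - 2 * L * (?d \<bullet> ?d)) \<le> 0"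
      by (intro mult_nonneg_nonpos) auto
    moreover have "at s within {a..b} = at s"
      using s t by (intro at_within_interior) auto
    ultimately show "\<exists>y. DERIV w s :> y \<and> y \<le> 0"
      using w'[OF sab] by (auto simp: has_real_derivative_iff_has_vector_derivative)
  qed
  then have "exp (- 2 * L * (t - a)) * ((u t - v t) \<bullet> (u t - v t)) \<le> 0"
    by (simp add: w_def init)
  then show ?thesis
    by (simp add: mult_le_0_iff not_le[symmetric] flip: power2_norm_eq_inner)
qed

text \<open>Existence uses a Lipschitz constant on the unit ball about the initial value. For uniqueness the constant is
taken on the union of the two trajectories, which is bounded because a solution is continuous on a compact
interval; the competitor may therefore be arbitrary.\<close>
lemma locally_lipschitz_ode_exists_unique:
  fixes G :: "'a::{banach, real_inner} \<Rightarrow> 'a" and t0 :: real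
  assumes lip: "\<And>X. bounded X \<Longrightarrow> \<exists>L. L-lipschitz_on X G"
  shows "\<exists>\<epsilon>>0. \<exists>u.
           (u t0 = x0 \<and> (\<forall>t\<in>{t0..t0 + \<epsilon>}.
              (u has_vector_derivative G (u t)) (at t within {t0..t0 + \<epsilon>}))) \<and>
           (\<forall>v. v t0 = x0 \<and> (\<forall>t\<in>{t0..t0 + \<epsilon>}.
                (v has_vector_derivative G (v t)) (at t within {t0..t0 + \<epsilon>})) \<longrightarrow>
              (\<forall>t\<in>{t0..t0 + \<epsilon>}. v t = u t))"
proof -
  obtain L where "L-lipschitz_on (cball x0 1) G"
    using lip[OF bounded_cball] by blast
  then obtain \<epsilon> u where \<epsilon>: "\<epsilon> > 0" and u0: "u t0 = x0"
    and u: "\<And>t. t \<in> {t0..t0 + \<epsilon>} \<Longrightarrow>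
              (u has_vector_derivative G (u t)) (at t within {t0..t0 + \<epsilon>})"
    by (rule lipschitz_ode_local_existence[of _ x0 1 G t0]) auto
  have bounded_range: "bounded (w ` {t0..t0 + \<epsilon>})"
    if "\<And>t. t \<in> {t0..t0 + \<epsilon>} \<Longrightarrow>
          (w has_vector_derivative G (w t)) (at t within {t0..t0 + \<epsilon>})" for w
    by (intro compact_imp_bounded compact_continuous_image compact_Icc
        continuous_on_vector_derivative[of _ w "\<lambda>t. G (w t)"] that)
  have "v t = u t"
    if v0: "v t0 = x0" and v: "\<And>t. t \<in> {t0..t0 + \<epsilon>} \<Longrightarrow>
          (v has_vector_derivative G (v t)) (at t within {t0..t0 + \<epsilon>})"
      and t: "t \<in> {t0..t0 + \<epsilon>}" for v t
  proof -
    let ?X = "u ` {t0..t0 + \<epsilon>} \<union> v ` {t0..t0 + \<epsilon>}"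
    have "bounded ?X"
      using bounded_range[OF u] bounded_range[OF v] by (simp add: bounded_Un)
    then obtain L where "L-lipschitz_on ?X G"
      using lip by blast
    then show ?thesis
      by (rule lipschitz_ode_unique[OF _ v u _ _ _ t]) (simp_all add: u0 v0)
  qed
  then show ?thesis
    using \<epsilon> u0 u by blast
qed

section \<open>Neural Galerkin trajectories\<close>

lemma neural_galerkin_iff_ode:
  assumes VV: "transpose V ** V = mat 1" and VW: "transpose V ** W = 0"
    and g: "\<And>\<theta> v. decoder_tangent V W \<theta> v \<bullet>
              (decoder_tangent V W \<theta> (g \<theta>) - F (decoder s0 V W \<theta>)) = 0"
  shows "solves_neural_galerkin (decoder s0 V W) F a b \<theta> \<longleftrightarrow>
    (\<forall>t\<in>{a..b}. (\<theta> has_vector_derivative g (\<theta> t)) (at t within {a..b}))"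
proof -
  have unique: "(\<forall>v. decoder_tangent V W x v \<bullet>
      (decoder_tangent V W x y - F (decoder s0 V W x)) = 0) \<longleftrightarrow> y = g x" for x y
  proof
    assume y: "\<forall>v. decoder_tangent V W x v \<bullet>
      (decoder_tangent V W x y - F (decoder s0 V W x)) = 0"
    \<comment> \<open>The image \<open>J x (y - g x)\<close> is a difference of two residuals, each orthogonal to the range
      of \<open>J x\<close>, and lies in that range itself.\<close>
    let ?d = "decoder_tangent V W x (y - g x)"
    have "?d = (decoder_tangent V W x y - F (decoder s0 V W x))
        - (decoder_tangent V W x (g x) - F (decoder s0 V W x))"
      by (simp add: linear_diff[OF linear_decoder_tangent])
    then have "?d \<bullet> ?d = 0"
      using y g by (metis inner_diff_right diff_self)
    then show "y = g x"
      using norm_le_norm_decoder_tangent[OF VV VW, of "y - g x" x] by simp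
  qed (simp add: g)
  show ?thesis
    unfolding solves_neural_galerkin_def partial_derivative_decoder jacobian_decoder
      inner_zero_on_axes_iff[OF linear_decoder_tangent] unique
    by blast
qed

theorem mainTheorem2:
  fixes S :: "real^'m^'N"
    and s0 :: "real^'N"
    and V :: "real^'n^'N"
    and W :: "real^('n \<times> 'n)^'N"
    and f :: "real^'N \<Rightarrow> real^'d \<Rightarrow> real^'N"
    and D :: "(real^'d) set"
    and \<gamma> T t0 :: real
    and \<mu> :: "real^'d"
    and \<theta>0 :: "real^'n"
  assumes "CARD('n) < CARD('N)"
    and "\<gamma> > 0"
    and "greedy_quadratic_manifold S s0 \<gamma> V W"
    and "\<forall>\<nu>\<in>D. continuously_differentiable (\<lambda>x. f x \<nu>)"
    and "t0 \<in> {0..<T}"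
    and "\<mu> \<in> D"
  shows "\<exists>\<epsilon>>0. \<exists>\<theta>.
           (\<theta> t0 = \<theta>0 \<and>
            solves_neural_galerkin (decoder s0 V W) (\<lambda>x. f x \<mu>) t0 (t0 + \<epsilon>) \<theta>) \<and>
           (\<forall>\<psi>. \<psi> t0 = \<theta>0 \<and>
                 solves_neural_galerkin (decoder s0 V W) (\<lambda>x. f x \<mu>) t0 (t0 + \<epsilon>) \<psi> \<longrightarrow>
                 (\<forall>t\<in>{t0..t0 + \<epsilon>}. \<psi> t = \<theta> t))"
proof -
  let ?q = "decoder s0 V W" and ?J = "decoder_tangent V W" and ?F = "\<lambda>x. f x \<mu>"
  have VV: "transpose V ** V = mat 1"
    using assms(3) orthonormal_columns_of_selection
    unfolding greedy_quadratic_manifold_def by blast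
  have VW: "transpose V ** W = 0"
    using assms(3) regression_minimizer_orthogonal[OF VV assms(2)]
    unfolding greedy_quadratic_manifold_def by blast
  have "\<forall>\<theta>. \<exists>y. \<forall>v. ?J \<theta> v \<bullet> (?J \<theta> y - ?F (?q \<theta>)) = 0"
    by (intro allI ex_galerkin_solution linear_decoder_tangent)
  from choice[OF this] obtain g where g: "\<And>\<theta> v. ?J \<theta> v \<bullet> (?J \<theta> (g \<theta>) - ?F (?q \<theta>)) = 0"
    by blast
  obtain K where K: "K > 0"
    "\<And>x y v. norm (?J x v - ?J y v) \<le> K * norm (x - y) * norm v"
    by (rule decoder_tangent_lipschitz[of V W]) blast
  have "\<exists>L. L-lipschitz_on X g" if X: "bounded X" for X
  proof -
    obtain C where C: "C-lipschitz_on X ?q"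
      using decoder_lipschitz_on_bounded[OF X] by blast
    have "bounded (?q ` X)"
      by (rule bounded_uniformly_continuous_image[OF lipschitz_on_uniformly_continuous[OF C] X])
    then obtain L where "L-lipschitz_on (?q ` X) ?F"
      using continuously_differentiable_imp_lipschitz_on_bounded[of ?F] assms(4,6) by blast
    from lipschitz_on_compose2[OF C this]
    have FC: "(L * C)-lipschitz_on X (\<lambda>\<theta>. ?F (?q \<theta>))" .
    have "bounded ((\<lambda>\<theta>. ?F (?q \<theta>)) ` X)"
      by (rule bounded_uniformly_continuous_image[OF lipschitz_on_uniformly_continuous[OF FC] X])
    then obtain M where "\<And>\<theta>. \<theta> \<in> X \<Longrightarrow> norm (?F (?q \<theta>)) \<le> M"
      unfolding bounded_iff by blast
    then show ?thesis
      using galerkin_velocity_lipschitz[OF linear_decoder_tangent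
          norm_le_norm_decoder_tangent[OF VV VW] K(2) less_imp_le[OF K(1)] FC _ g]
      by blast
  qed
  from locally_lipschitz_ode_exists_unique[OF this]
  show ?thesis
    unfolding neural_galerkin_iff_ode[OF VV VW g] .
qed

end
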